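(* For every large enough integer $n$ and an integer $k=O(n^{1/4})$, there exists an $n$-vertex $k$-edge-connected graph of diameter $4$, for which computing a minimum spanning tree requires $\widetilde{\Omega}((n/k)^{1/3})$ rounds.
   Context: Rounds are counted in the standard CONGEST model: the input graph (simple, with edge weights) is the communication network; each node has a processor with a unique ID of $O(\log n)$ bits; execution proceeds in synchronous rounds, and in every round each node can send a message of $O(\log n)$ bits to each of its neighbors. Computing a minimum spanning tree (MST) means each node learns which of its incident edges belong to the MST; the lower bound is for the worst case over assignments of weights to the edges of the graph. The diameter is the unweighted (hop) diameter. $\widetilde{\Omega}$ hides factors polylogarithmic in $n$. *)

theory Defs
  imports "HOL-Probability.Probability"
begin

section \<open>Finite simple graphs\<close>

text \<open>A graph is given by its vertex set and its set of edges, an edge being the two-element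
  set of its endpoints.\<close>

definition simple_graph :: "'v set \<Rightarrow> 'v set set \<Rightarrow> bool" where
  "simple_graph V E \<longleftrightarrow> finite V \<and> (\<forall>e\<in>E. e \<subseteq> V \<and> card e = 2)"

definition walk :: "'v set \<Rightarrow> 'v set set \<Rightarrow> 'v \<Rightarrow> 'v list \<Rightarrow> 'v \<Rightarrow> bool" where
  "walk V E u xs v \<longleftrightarrow> xs \<noteq> [] \<and> set xs \<subseteq> V \<and> hd xs = u \<and> last xs = v \<and>
     successively (\<lambda>x y. {x, y} \<in> E) xs"

definition graph_connected :: "'v set \<Rightarrow> 'v set set \<Rightarrow> bool" where
  "graph_connected V E \<longleftrightarrow> V \<noteq> {} \<and> (\<forall>u\<in>V. \<forall>v\<in>V. \<exists>xs. walk V E u xs v)"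

text \<open>A walk visiting the list \<open>xs\<close> of vertices uses \<open>length xs - 1\<close> edges. Both definitions below
  are meaningful only for finite connected graphs.\<close>

definition hop_dist :: "'v set \<Rightarrow> 'v set set \<Rightarrow> 'v \<Rightarrow> 'v \<Rightarrow> nat" where
  "hop_dist V E u v = (LEAST l. \<exists>xs. walk V E u xs v \<and> l = length xs - 1)"

definition hop_diameter :: "'v set \<Rightarrow> 'v set set \<Rightarrow> nat" where
  "hop_diameter V E = Max {hop_dist V E u v | u v. u \<in> V \<and> v \<in> V}"

definition k_edge_connected :: "nat \<Rightarrow> 'v set \<Rightarrow> 'v set set \<Rightarrow> bool" where
  "k_edge_connected k V E \<longleftrightarrow> card V > 1 \<and>
     (\<forall>F. F \<subseteq> E \<and> finite F \<and> card F < k \<longrightarrow> graph_connected V (E - F))"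

definition has_cycle :: "'v set set \<Rightarrow> bool" where
  "has_cycle E \<longleftrightarrow> (\<exists>xs. length xs \<ge> 3 \<and> distinct xs \<and>
     successively (\<lambda>x y. {x, y} \<in> E) xs \<and> {last xs, hd xs} \<in> E)"

definition spanning_tree :: "'v set \<Rightarrow> 'v set set \<Rightarrow> 'v set set \<Rightarrow> bool" where
  "spanning_tree V E F \<longleftrightarrow> F \<subseteq> E \<and> graph_connected V F \<and> \<not> has_cycle F"

definition is_mst :: "'v set \<Rightarrow> 'v set set \<Rightarrow> ('v set \<Rightarrow> nat) \<Rightarrow> 'v set set \<Rightarrow> bool" where
  "is_mst V E w F \<longleftrightarrow> spanning_tree V E F \<and>
     (\<forall>F'. spanning_tree V E F' \<longrightarrow> sum w F \<le> sum w F')"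

section \<open>The CONGEST model\<close>

text \<open>The vertices of the communication network are natural numbers, which serve as the unique
  identifiers of the nodes; an \<open>n\<close>-vertex network has vertex set \<open>{..<n}\<close>, so identifiers have
  \<open>O(log n)\<close> bits.

  A message is a bit string; the empty string stands for silence. The input of a node consists of
  the weights of its incident edges, indexed by the other endpoint. The history of a node lists,
  round by round, the messages it received, indexed by the sender.

  Local computation is unrestricted, so a node may as well remember everything it has seen: what a
  node sends and outputs is an arbitrary function of its identifier, its input, its
  private infinite sequence of random bits and its history. An algorithm may be tailored to a
  particular network, since its behaviour may depend on the identifier in an arbitrary way. A
  deterministic algorithm is one that ignores the random bits.\<close>

type_synonym message = "bool list"
type_synonym input = "nat \<Rightarrow> nat option"
type_synonym coins = "nat \<Rightarrow> bool"
type_synonym history = "(nat \<Rightarrow> message) list"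

record congest_alg =
  send :: "nat \<Rightarrow> input \<Rightarrow> coins \<Rightarrow> history \<Rightarrow> nat \<Rightarrow> message"
    \<comment> \<open>the last argument is the neighbour to which the message is addressed\<close>
  answer :: "nat \<Rightarrow> input \<Rightarrow> coins \<Rightarrow> history \<Rightarrow> nat set set"

definition local_input :: "nat set set \<Rightarrow> (nat set \<Rightarrow> nat) \<Rightarrow> nat \<Rightarrow> input" where
  "local_input E w v = (\<lambda>u. if {u, v} \<in> E then Some (w {u, v}) else None)"

text \<open>The argument \<open>\<omega>\<close> supplies the random bits of all nodes: \<open>\<omega> (v, i)\<close> is the \<open>i\<close>-th random bit of
  node \<open>v\<close>. In round \<open>t + 1\<close>, every node sends messages determined by its history of the first \<open>t\<close>
  rounds.\<close>

primrec run :: "nat set set \<Rightarrow> congest_alg \<Rightarrow> (nat set \<Rightarrow> nat) \<Rightarrow> (nat \<times> nat \<Rightarrow> bool) \<Rightarrow>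
    nat \<Rightarrow> nat \<Rightarrow> history" where
  "run E A w \<omega> 0 = (\<lambda>v. [])"
| "run E A w \<omega> (Suc t) = (\<lambda>v. run E A w \<omega> t v @
     [\<lambda>u. if {u, v} \<in> E
          then send A u (local_input E w u) (\<lambda>i. \<omega> (u, i)) (run E A w \<omega> t u) v
          else []])"

definition result :: "nat set set \<Rightarrow> congest_alg \<Rightarrow> (nat set \<Rightarrow> nat) \<Rightarrow> (nat \<times> nat \<Rightarrow> bool) \<Rightarrow>
    nat \<Rightarrow> nat \<Rightarrow> nat set set" where
  "result E A w \<omega> t v = answer A v (local_input E w v) (\<lambda>i. \<omega> (v, i)) (run E A w \<omega> t v)"

definition bandwidth :: "congest_alg \<Rightarrow> real \<Rightarrow> bool" where
  "bandwidth A B \<longleftrightarrow> (\<forall>v x r h u. real (length (send A v x r h u)) \<le> B)"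

definition coin_space :: "(nat \<times> nat \<Rightarrow> bool) measure" where
  "coin_space = (\<Pi>\<^sub>M p\<in>UNIV. measure_pmf (bernoulli_pmf (1/2)))"

text \<open>Each node has to learn which of its incident edges belong to the tree. If the minimum
  spanning tree is not unique, all nodes have to agree on the same one.\<close>

definition outputs_mst :: "nat set \<Rightarrow> nat set set \<Rightarrow> congest_alg \<Rightarrow> (nat set \<Rightarrow> nat) \<Rightarrow>
    (nat \<times> nat \<Rightarrow> bool) \<Rightarrow> nat \<Rightarrow> bool" where
  "outputs_mst V E A w \<omega> t \<longleftrightarrow>
     (\<exists>F. is_mst V E w F \<and> (\<forall>v\<in>V. result E A w \<omega> t v = {e \<in> F. v \<in> e}))"

text \<open>Edge weights are positive integers polynomially bounded in the number of vertices, so that a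
  weight fits into a constant number of messages. The algorithm has to succeed with probability
  at least \<open>2/3\<close> for every weight assignment; for a deterministic algorithm this amounts to
  always succeeding.\<close>

definition computes_mst :: "nat set \<Rightarrow> nat set set \<Rightarrow> congest_alg \<Rightarrow> nat \<Rightarrow> bool" where
  "computes_mst V E A t \<longleftrightarrow>
     (\<forall>w. (\<forall>e\<in>E. 1 \<le> w e \<and> w e \<le> card V ^ 2) \<longrightarrow>
        {\<omega> \<in> space coin_space. outputs_mst V E A w \<omega> t} \<in> sets coin_space \<and>
        measure coin_space {\<omega> \<in> space coin_space. outputs_mst V E A w \<omega> t} \<ge> 2/3)"

end

(* Take m paths of length L, blow every path vertex up to an independent set of at least k vertices,
   join column j of the paths to a hub j, and join the L hubs to a centre; this has diameter 4 and
   about m L k vertices. An m-bit string is written into the weights of the edges between the first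
   hub and the paths in such a way that it decides which edges between the last hub and the paths
   lie in a minimum spanning tree. Hence the last hub must learn m bits. In fewer than L - 1 rounds
   they can reach it only through the centre, which receives at most L messages of O(log n) bits
   per round. So t rounds need t >= L - 1 or t L log n >= m up to constants, and L of order
   (n/k)^(1/3) balances the two. Since every output bit is prescribed, counting transcripts for one
   good choice of the coins suffices also for randomised algorithms. *)

theory Submission
  imports Defs "HOL-Real_Asymp.Real_Asymp"
begin

section \<open>Reachability and minimum spanning trees\<close>

definition adj :: "'v set set \<Rightarrow> ('v \<times> 'v) set" where
  "adj E = {(x, y). {x, y} \<in> E}"

lemma in_adj [simp]: "(x, y) \<in> adj E \<longleftrightarrow> {x, y} \<in> E"
  by (simp add: adj_def)

lemma adj_mono: "E \<subseteq> E' \<Longrightarrow> adj E \<subseteq> adj E'"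
  by (auto simp: adj_def)

lemma sym_adj: "sym (adj E)"
  by (auto simp: sym_def adj_def insert_commute)

lemma reach_sym: "(u, v) \<in> (adj E)\<^sup>* \<Longrightarrow> (v, u) \<in> (adj E)\<^sup>*"
  by (meson sym_adj sym_rtrancl symD)

lemma reach_mono: "(u, v) \<in> (adj E)\<^sup>* \<Longrightarrow> E \<subseteq> E' \<Longrightarrow> (u, v) \<in> (adj E')\<^sup>*"
  by (meson adj_mono rtrancl_mono subsetD)

text \<open>Moves distances and connectedness to relation powers and closures. A walk with
  \<open>l\<close> edges lists \<open>Suc l\<close> vertices; the induction peels off the first
  one.\<close>

lemma walk_iff_relpow:
  assumes "\<forall>e\<in>E. e \<subseteq> V"
  shows "u \<in> V \<Longrightarrow> (\<exists>xs. walk V E u xs v \<and> length xs = Suc l) \<longleftrightarrow> (u, v) \<in> adj E ^^ l"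
proof (induction l arbitrary: u)
  case 0
  have "walk V E u [u] u"
    using 0 by (simp add: walk_def)
  then show ?case
    by (auto simp: walk_def length_Suc_conv intro!: exI[of _ "[v]"])
next
  case (Suc l)
  show ?case
  proof
    assume "\<exists>xs. walk V E u xs v \<and> length xs = Suc (Suc l)"
    then obtain y ys where w: "walk V E u (u # y # ys) v" and l: "length (y # ys) = Suc l"
      by (auto simp: walk_def length_Suc_conv)
    then have "walk V E y (y # ys) v" and e: "{u, y} \<in> E" and y: "y \<in> V"
      by (auto simp: walk_def)
    with l Suc.IH[of y] have "(y, v) \<in> adj E ^^ l"
      by blast
    with e show "(u, v) \<in> adj E ^^ Suc l"
      by (meson in_adj relpow_Suc_I2)
  next
    assume "(u, v) \<in> adj E ^^ Suc l"
    then obtain y where e: "{u, y} \<in> E" and y: "(y, v) \<in> adj E ^^ l"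
      by (meson in_adj relpow_Suc_D2)
    moreover from e assms have "y \<in> V"
      by blast
    ultimately obtain ys where ys: "walk V E y ys v" "length ys = Suc l"
      using Suc.IH[of y] by blast
    then have "walk V E u (u # ys) v"
      using e Suc.prems by (cases ys) (auto simp: walk_def)
    with ys(2) show "\<exists>xs. walk V E u xs v \<and> length xs = Suc (Suc l)"
      by (metis length_Cons)
  qed
qed

lemma ex_walk_iff:
  assumes "\<forall>e\<in>E. e \<subseteq> V" and "u \<in> V"
  shows "(\<exists>xs. walk V E u xs v) \<longleftrightarrow> (u, v) \<in> (adj E)\<^sup>*"
proof -
  have "(\<exists>xs. walk V E u xs v) \<longleftrightarrow> (\<exists>l xs. walk V E u xs v \<and> length xs = Suc l)"
    by (metis length_0_conv not0_implies_Suc walk_def)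
  then show ?thesis
    using walk_iff_relpow[OF assms] by (simp add: rtrancl_power)
qed

lemma graph_connected_iff:
  assumes "\<forall>e\<in>E. e \<subseteq> V"
  shows "graph_connected V E \<longleftrightarrow> V \<noteq> {} \<and> (\<forall>u\<in>V. \<forall>v\<in>V. (u, v) \<in> (adj E)\<^sup>*)"
  using ex_walk_iff[OF assms] by (simp add: graph_connected_def)

lemma hop_dist_eq:
  assumes "\<forall>e\<in>E. e \<subseteq> V" and "u \<in> V"
  shows "hop_dist V E u v = (LEAST l. (u, v) \<in> adj E ^^ l)"
proof -
  have "(\<exists>xs. walk V E u xs v \<and> l = length xs - 1) \<longleftrightarrow> (u, v) \<in> adj E ^^ l" for l
  proof -
    have "(\<exists>xs. walk V E u xs v \<and> l = length xs - 1) \<longleftrightarrow>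
        (\<exists>xs. walk V E u xs v \<and> length xs = Suc l)"
      by (metis Suc_pred' diff_Suc_1 length_greater_0_conv walk_def)
    then show ?thesis
      using walk_iff_relpow[OF assms] by simp
  qed
  then show ?thesis
    by (simp add: hop_dist_def)
qed

lemma relpow_adj_potential:
  fixes f :: "'v \<Rightarrow> nat"
  assumes "\<And>x y. {x, y} \<in> E \<Longrightarrow> f y \<le> Suc (f x)" and "(u, v) \<in> adj E ^^ l"
  shows "f v \<le> f u + l"
  using assms(2)
proof (induction l arbitrary: v)
  case (Suc l)
  then obtain y where "(u, y) \<in> adj E ^^ l" "{y, v} \<in> E"
    by auto
  then show ?case
    using Suc.IH[of y] assms(1)[of y v] by simp
qed simp

text \<open>Short walks give the upper bound. The potential \<open>f\<close> rises by at most one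
  per edge and climbs from 0 at \<open>u\<close> to \<open>d\<close> at \<open>v\<close>, so this
  pair attains it.\<close>

lemma hop_diameter_eqI:
  assumes E: "\<forall>e\<in>E. e \<subseteq> V" and "finite V"
    and le: "\<And>u v. u \<in> V \<Longrightarrow> v \<in> V \<Longrightarrow> \<exists>l\<le>d. (u, v) \<in> adj E ^^ l"
    and f: "\<And>x y. {x, y} \<in> E \<Longrightarrow> f y \<le> Suc (f x)"
    and uv: "u \<in> V" "v \<in> V" "f u = 0" "f v = d"
  shows "hop_diameter V E = d"
proof -
  have ub: "hop_dist V E x y \<le> d" if "x \<in> V" "y \<in> V" for x y
    using le[OF that] hop_dist_eq[OF E that(1)] by (metis (mono_tags) Least_le order_trans)
  have "(u, v) \<in> adj E ^^ hop_dist V E u v"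
    using le[OF uv(1,2)] unfolding hop_dist_eq[OF E uv(1)] by (metis (mono_tags) LeastI)
  from relpow_adj_potential[of E f, OF f this] have "d \<le> hop_dist V E u v"
    using uv by simp
  with ub[OF uv(1,2)] have d: "hop_dist V E u v = d"
    by simp
  have "{hop_dist V E x y |x y. x \<in> V \<and> y \<in> V} = (\<lambda>(x, y). hop_dist V E x y) ` (V \<times> V)"
    by auto
  then have "finite {hop_dist V E x y |x y. x \<in> V \<and> y \<in> V}"
    using \<open>finite V\<close> by simp
  then show ?thesis
    unfolding hop_diameter_def using ub d uv(1,2) by (intro Max_eqI) auto
qed

section \<open>Spanning trees and the exchange argument\<close>

lemma graph_connected_remove_edge:
  assumes F: "\<forall>e\<in>F. e \<subseteq> V" and "graph_connected V F" and "(a, b) \<in> (adj (F - {{a, b}}))\<^sup>*"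
  shows "graph_connected V (F - {{a, b}})"
proof -
  let ?R = "(adj (F - {{a, b}}))\<^sup>*"
  have "(x, y) \<in> ?R" if "{x, y} \<in> F" for x y
  proof (cases "{x, y} = {a, b}")
    case True
    then show ?thesis
      using assms(3) reach_sym by (metis doubleton_eq_iff)
  next
    case False
    then have "(x, y) \<in> adj (F - {{a, b}})"
      using that by simp
    then show ?thesis
      by blast
  qed
  then have "adj F \<subseteq> ?R"
    by (auto simp: adj_def)
  then have "(adj F)\<^sup>* \<subseteq> ?R"
    using rtrancl_subset_rtrancl by blast
  with assms(2) F show ?thesis
    using graph_connected_iff[of "F - {{a, b}}" V] graph_connected_iff[OF F] by blast
qed

lemma successively_reach:
  assumes "successively (\<lambda>x y. {x, y} \<in> E) (x # xs)"
  shows "(x, last (x # xs)) \<in> (adj E)\<^sup>*"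
  using assms
proof (induction xs arbitrary: x)
  case (Cons y ys)
  then have "(y, last (y # ys)) \<in> (adj E)\<^sup>*" "(x, y) \<in> adj E"
    by auto
  then show ?case
    by (metis converse_rtrancl_into_rtrancl last_ConsR list.distinct(1))
qed simp

text \<open>A connected edge set with fewest edges is acyclic, since deleting an edge of a cycle
  keeps it connected.\<close>

lemma connected_has_spanning_tree:
  assumes E: "\<forall>e\<in>E. e \<subseteq> V" and fin: "finite E" and con: "graph_connected V E"
  shows "\<exists>T. spanning_tree V E T"
proof -
  define T where "T = arg_min card (\<lambda>T. T \<subseteq> E \<and> graph_connected V T)"
  have T: "T \<subseteq> E" "graph_connected V T"
    and min: "\<And>T'. T' \<subseteq> E \<Longrightarrow> graph_connected V T' \<Longrightarrow> card T \<le> card T'"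
    using arg_min_nat_lemma[of "\<lambda>T. T \<subseteq> E \<and> graph_connected V T" E card] con
    unfolding T_def by auto
  have "\<not> has_cycle T"
  proof
    assume "has_cycle T"
    then obtain xs where xs: "length xs \<ge> 3" "distinct xs"
      "successively (\<lambda>x y. {x, y} \<in> T) xs" "{last xs, hd xs} \<in> T"
      by (auto simp: has_cycle_def)
    \<comment> \<open>The closing edge from \<open>last ys\<close> to \<open>a\<close> gets deleted;
      with at least three vertices the rest of the cycle is a detour through \<open>b\<close> that
      avoids it.\<close>
    then obtain a b ys where xs_eq: "xs = a # b # ys" and ys: "ys \<noteq> []"
      by (auto simp: numeral_3_eq_3 Suc_le_length_iff)
    let ?z = "last ys"
    have z: "?z \<in> set ys" "?z \<noteq> a" "?z \<noteq> b" and "{a, ?z} \<in> T"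
      using xs ys by (auto simp: xs_eq insert_commute)
    have "successively (\<lambda>x y. {x, y} \<in> T - {{a, ?z}}) (b # ys)"
      by (rule successively_mono[of "\<lambda>x y. {x, y} \<in> T"])
        (use xs in \<open>auto simp: xs_eq doubleton_eq_iff\<close>)
    then have "(b, ?z) \<in> (adj (T - {{a, ?z}}))\<^sup>*"
      using successively_reach ys by fastforce
    moreover have "(a, b) \<in> adj (T - {{a, ?z}})"
      using xs z by (auto simp: xs_eq doubleton_eq_iff)
    ultimately have "(a, ?z) \<in> (adj (T - {{a, ?z}}))\<^sup>*"
      by (rule converse_rtrancl_into_rtrancl[rotated])
    then have "graph_connected V (T - {{a, ?z}})"
      using T E by (intro graph_connected_remove_edge) auto
    then have "card T \<le> card (T - {{a, ?z}})"
      using T min by blast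
    moreover have "card (T - {{a, ?z}}) < card T"
      using \<open>{a, ?z} \<in> T\<close> T fin by (intro card_Diff1_less) (auto dest: finite_subset)
    ultimately show False
      by simp
  qed
  with T show ?thesis
    by (auto simp: spanning_tree_def)
qed

text \<open>Any connected spanning edge set contains a spanning tree, and further edges cannot lower
  the weight. Exchange arguments thus need no check of acyclicity.\<close>

lemma is_mst_le_connected:
  assumes "\<forall>e\<in>E. e \<subseteq> V" and "finite E" and mst: "is_mst V E w F"
    and "F' \<subseteq> E" and "graph_connected V F'"
  shows "sum w F \<le> sum w F'"
proof -
  have fin: "finite F'"
    using assms(2,4) by (rule finite_subset[rotated])
  obtain T where "spanning_tree V F' T"
    using connected_has_spanning_tree[of F' V] assms fin by blast
  then have "spanning_tree V E T" "T \<subseteq> F'"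
    using assms(4) by (auto simp: spanning_tree_def)
  then have "sum w F \<le> sum w T"
    using mst by (auto simp: is_mst_def)
  also have "\<dots> \<le> sum w F'"
    using fin \<open>T \<subseteq> F'\<close> by (intro sum_mono2) auto
  finally show ?thesis .
qed

lemma rtrancl_crossing:
  assumes "(u, v) \<in> R\<^sup>*" and "u \<in> S" and "v \<notin> S"
  shows "\<exists>a b. (a, b) \<in> R \<and> a \<in> S \<and> b \<notin> S"
  using assms by (induction rule: rtrancl_induct) blast+

text \<open>The cycle property of minimum spanning trees. If \<open>u\<close> and \<open>v\<close>
  stay connected without \<open>{u, v}\<close>, dropping that edge saves its positive weight;
  otherwise the light path crosses the cut in a cheaper replacement.\<close>

lemma is_mst_no_lighter_path:
  assumes E: "\<forall>e\<in>E. e \<subseteq> V" and fin: "finite E" and mst: "is_mst V E w F"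
    and uvF: "{u, v} \<in> F" and pos: "w {u, v} > 0"
    and light: "(u, v) \<in> (adj {e \<in> E. w e < w {u, v}})\<^sup>*"
  shows False
proof -
  define D where "D = F - {{u, v}}"
  have F: "F \<subseteq> E" "graph_connected V F"
    using mst by (auto simp: is_mst_def spanning_tree_def)
  then have finF: "finite F" and FV: "\<forall>e\<in>F. e \<subseteq> V"
    using fin E by (auto intro: finite_subset)
  have sumF: "sum w F = w {u, v} + sum w D"
    unfolding D_def using finF uvF by (rule sum.remove)
  show False
  proof (cases "(u, v) \<in> (adj D)\<^sup>*")
    case True
    then have "graph_connected V D"
      using graph_connected_remove_edge[OF FV F(2)] unfolding D_def by simp
    then have "sum w F \<le> sum w D"
      using F by (intro is_mst_le_connected[OF E fin mst]) (auto simp: D_def)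
    with sumF pos show False
      by simp
  next
    case False
    \<comment> \<open>The light path leaves the component of \<open>u\<close> in \<open>D\<close>;
      the crossing edge is the replacement.\<close>
    obtain a b where ab: "{a, b} \<in> E" "w {a, b} < w {u, v}"
      and a: "(u, a) \<in> (adj D)\<^sup>*" and b: "(u, b) \<notin> (adj D)\<^sup>*"
      using rtrancl_crossing[OF light, of "{x. (u, x) \<in> (adj D)\<^sup>*}"] False
      by (auto simp del: in_adj) (auto simp: adj_def)
    define G where "G = insert {a, b} D"
    have GV: "\<forall>e\<in>G. e \<subseteq> V" and GE: "G \<subseteq> E"
      using ab E F by (auto simp: G_def D_def)
    have D_G: "(x, y) \<in> (adj G)\<^sup>*" if "(x, y) \<in> (adj D)\<^sup>*" for x y
      using that by (rule reach_mono) (auto simp: G_def)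
    \<comment> \<open>After the removal every vertex still hangs on \<open>u\<close> or on
      \<open>v\<close>, so rejoining these two parts restores connectedness.\<close>
    have split: "(u, x) \<in> (adj D)\<^sup>* \<or> (v, x) \<in> (adj D)\<^sup>*" if "(u, x) \<in> (adj F)\<^sup>*" for x
      using that
    proof (induction rule: rtrancl_induct)
      case (step y z)
      show ?case
      proof (cases "{y, z} = {u, v}")
        case True
        then show ?thesis
          by (auto simp: doubleton_eq_iff)
      next
        case False
        then have "(y, z) \<in> adj D"
          using step by (auto simp: D_def)
        then show ?thesis
          using step.IH rtrancl_into_rtrancl[of _ y "adj D" z] by blast
      qed
    qed simp
    have uV: "u \<in> V" "v \<in> V" "b \<in> V"
      using uvF FV ab E by auto
    have uF: "(u, x) \<in> (adj F)\<^sup>*" if "x \<in> V" for x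
      using F(2) uV(1) that graph_connected_iff[OF FV] by blast
    have "(v, b) \<in> (adj D)\<^sup>*"
      using split[OF uF[OF uV(3)]] b by simp
    then have "(b, v) \<in> (adj G)\<^sup>*"
      by (rule reach_sym[OF D_G])
    moreover have "(a, b) \<in> adj G"
      by (simp add: G_def)
    ultimately have "(u, v) \<in> (adj G)\<^sup>*"
      using D_G[OF a] rtrancl_into_rtrancl[of u a "adj G" b] rtrancl_trans[of u b "adj G" v] by blast
    then have uG: "(u, x) \<in> (adj G)\<^sup>*" if "x \<in> V" for x
      using split[OF uF[OF that]] D_G[of u x] D_G[of v x] rtrancl_trans[of u v "adj G" x] by blast
    have "(x, y) \<in> (adj G)\<^sup>*" if "x \<in> V" "y \<in> V" for x y
      using reach_sym[OF uG[OF that(1)]] uG[OF that(2)] by (rule rtrancl_trans)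
    then have "graph_connected V G"
      using graph_connected_iff[OF GV] uV(1) by blast
    then have "sum w F \<le> sum w G"
      using is_mst_le_connected[OF E fin mst GE] by blast
    also have "\<dots> \<le> w {a, b} + sum w D"
      unfolding G_def using finF by (cases "{a, b} \<in> D") (simp_all add: D_def insert_absorb)
    finally show False
      using sumF ab by simp
  qed
qed

section \<open>Coins and transcripts\<close>

text \<open>The expected number of events that occur is at least \<open>p * card X\<close>, so some
  outcome reaches this value. It turns random coins into one fixed choice that is good for a
  \<open>p\<close> fraction of the inputs.\<close>

lemma (in prob_space) ex_outcome_average:
  assumes "finite X" "X \<noteq> {}" and S: "\<And>x. x \<in> X \<Longrightarrow> S x \<in> events"
    and p: "\<And>x. x \<in> X \<Longrightarrow> p \<le> prob (S x)"
  shows "\<exists>\<omega>\<in>space M. p * card X \<le> card {x \<in> X. \<omega> \<in> S x}"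
proof (rule ccontr)
  assume *: "\<not> ?thesis"
  let ?f = "\<lambda>\<omega>. \<Sum>x\<in>X. indicator (S x) \<omega> :: real"
  have f: "?f \<omega> = card {x \<in> X. \<omega> \<in> S x}" for \<omega>
    using \<open>finite X\<close> by (simp add: indicator_def sum.If_cases Int_def)
  have int: "integrable M (indicator (S x) :: _ \<Rightarrow> real)" if "x \<in> X" for x
    using S[OF that] by (intro integrable_real_indicator) (auto simp: emeasure_eq_measure)
  have "expectation ?f < p * card X"
  proof (rule expectation_less)
    show "integrable M ?f"
      using int by simp
    show "AE \<omega> in M. ?f \<omega> < p * card X"
      unfolding f using * by (auto simp: not_le)
  qed
  moreover have "expectation ?f = (\<Sum>x\<in>X. prob (S x))"
    using int S by (simp add: Bochner_Integration.integral_sum)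
  moreover have "(\<Sum>x\<in>X. prob (S x)) \<ge> (\<Sum>x\<in>X. p)"
    using p by (rule sum_mono)
  ultimately show False
    by (simp add: mult.commute)
qed

lemma prob_space_coin_space: "prob_space coin_space"
  unfolding coin_space_def by (intro prob_space_PiM prob_space_measure_pmf)

section \<open>Counting transcripts\<close>

lemma card_messages_le: "card {m :: message. length m \<le> b} \<le> 2 ^ Suc b"
proof -
  have "card {m :: message. length m \<le> b} = (\<Sum>i\<le>b. 2 ^ i)"
    using card_lists_length_le[of "UNIV :: bool set" b] by simp
  also have "\<dots> = 2 ^ Suc b - (1::nat)"
    by (induction b) auto
  finally show ?thesis
    by simp
qed

lemma finite_messages: "finite {m :: message. length m \<le> b}"
  using finite_lists_length_le[of "UNIV :: bool set" b] by simp

text \<open>Silence is the default value outside \<open>N\<close>, which makes the set of possible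
  rounds finite; each of the \<open>t\<close> rounds offers at most \<open>2 ^ Suc b\<close>
  messages per sender.\<close>

lemma card_histories_le:
  fixes b t :: nat
  assumes "finite N"
  defines "H \<equiv> {h :: history. length h = t \<and>
    (\<forall>f\<in>set h. (\<forall>u\<in>N. length (f u) \<le> b) \<and> (\<forall>u. u \<notin> N \<longrightarrow> f u = []))}"
  shows "finite H \<and> card H \<le> 2 ^ (Suc b * card N * t)"
proof -
  let ?P = "PiE_dflt N [] (\<lambda>_. {m :: message. length m \<le> b})"
  have H: "H = {h. set h \<subseteq> ?P \<and> length h = t}"
    unfolding H_def PiE_dflt_def by (fastforce simp: subset_iff)
  have "finite ?P"
    using assms(1) finite_messages by (intro finite_PiE_dflt) auto
  then have "finite H" "card H = card ?P ^ t"
    unfolding H by (auto simp: finite_lists_length_eq card_lists_length_eq)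
  moreover have "card ?P = card {m :: message. length m \<le> b} ^ card N"
    using assms(1) finite_messages by (subst card_PiE_dflt) auto
  moreover have "\<dots> \<le> (2 ^ Suc b) ^ card N"
    using card_messages_le by (rule power_mono) simp
  ultimately have "card H \<le> ((2 ^ Suc b) ^ card N) ^ t"
    by (simp only: power_mono zero_le)
  then show ?thesis
    using \<open>finite H\<close> by (simp only: power_mult)
qed

lemma length_run [simp]: "length (run E A w \<omega> t v) = t"
  by (induction t) auto

text \<open>Histories only grow, so equal histories of a node at time \<open>T\<close> force equal
  ones at all earlier times.\<close>

lemma take_run: "t \<le> T \<Longrightarrow> take t (run E A w \<omega> T v) = run E A w \<omega> t v"
  by (induction T) (auto simp: le_Suc_eq)

lemma run_message:
  assumes "f \<in> set (run E A w \<omega> t v)"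
  shows "f u = [] \<or> {u, v} \<in> E \<and> (\<exists>x r h. f u = send A u x r h v)"
  using assms
proof (induction t)
  case (Suc t)
  then consider "f \<in> set (run E A w \<omega> t v)" | "f = (\<lambda>u. if {u, v} \<in> E
      then send A u (local_input E w u) (\<lambda>i. \<omega> (u, i)) (run E A w \<omega> t u) v else [])"
    by auto
  then show ?case
  proof cases
    case 1
    then show ?thesis
      by (rule Suc.IH)
  next
    case 2
    then show ?thesis
      by (cases "{u, v} \<in> E") (simp_all, blast)
  qed
qed simp

section \<open>The network\<close>

text \<open>Pigeonhole: each forbidden \<open>e\<close> spoils at most one candidate. It finds an
  intact edge when fewer edges are deleted than there are choices for its end.\<close>

lemma ex_avoiding:
  assumes "finite D" "card D < card W"
    and "\<And>w w' e. \<lbrakk>w \<in> W; w' \<in> W; e \<in> D; r w e; r w' e\<rbrakk> \<Longrightarrow> w = w'"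
  shows "\<exists>w\<in>W. \<forall>e\<in>D. \<not> r w e"
  using card_le_if_inj_on_rel[of D W r] assms by (meson not_le)

text \<open>Vertex 0 is the centre, the vertices \<open>1, \<dots>, L\<close> are its neighbours (the hubs), and the remaining
  ones form \<open>m\<close> rows; hub \<open>h\<close> serves column \<open>h - 1\<close>. Every row is a path of length \<open>L\<close> whose
  vertices are replaced by independent sets (sites) of at least \<open>k\<close> vertices.\<close>

locale blown_up_grid =
  fixes n L m k :: nat
  assumes L5: "5 \<le> L" and k1: "1 \<le> k" and kL: "k \<le> L" and m1: "1 \<le> m"
    and size: "Suc L + m * k * L \<le> n"
begin

definition col :: "nat \<Rightarrow> nat" where
  "col v = (v - Suc L) mod L"

text \<open>The final \<open>mod m\<close> wraps surplus vertices around, so for arbitrary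
  \<open>n\<close> every vertex above \<open>L\<close> belongs to some site.\<close>

definition row :: "nat \<Rightarrow> nat" where
  "row v = (v - Suc L) div L mod m"

definition site :: "nat \<Rightarrow> nat \<Rightarrow> nat set" where
  "site i j = {v. L < v \<and> v < n \<and> row v = i \<and> col v = j}"

text \<open>Complete bipartite graphs between consecutive sites of a row.\<close>

definition rails :: "nat set set" where
  "rails = {{u, v} | u v. L < u \<and> u < n \<and> L < v \<and> v < n \<and> row u = row v \<and> col v = Suc (col u)}"

definition edges :: "nat set set" where
  "edges = {{0, h} | h. 1 \<le> h \<and> h \<le> L} \<union> {{Suc (col v), v} | v. L < v \<and> v < n} \<union> rails"

lemma col_less [simp]: "col v < L"
  using L5 by (simp add: col_def)

lemma Suc_col_le [simp]: "Suc (col v) \<le> L"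
  by (simp add: Suc_leI)

lemma row_less [simp]: "row v < m"
  using m1 by (simp add: row_def)

lemma L_less_n: "L < n"
  using size by simp

lemma rail_edge:
  "u \<in> site i j \<Longrightarrow> v \<in> site i (Suc j) \<Longrightarrow> {u, v} \<in> rails"
  unfolding rails_def site_def by fastforce

lemma rails_subset: "rails \<subseteq> edges"
  by (auto simp: edges_def)

lemma star_edge: "1 \<le> h \<Longrightarrow> h \<le> L \<Longrightarrow> {0, h} \<in> edges"
  by (auto simp: edges_def)

lemma spoke_edge: "L < v \<Longrightarrow> v < n \<Longrightarrow> {Suc (col v), v} \<in> edges"
  by (auto simp: edges_def)

lemma edge_cases:
  assumes "{u, v} \<in> edges"
  obtains (star) "u = 0" "1 \<le> v" "v \<le> L"
    | (star') "v = 0" "1 \<le> u" "u \<le> L"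
    | (spoke) "u = Suc (col v)" "L < v" "v < n"
    | (spoke') "v = Suc (col u)" "L < u" "u < n"
    | (rail) "L < u" "L < v" "u < n" "v < n" "row u = row v" "col v = Suc (col u)"
    | (rail') "L < u" "L < v" "u < n" "v < n" "row u = row v" "col u = Suc (col v)"
  using assms unfolding edges_def rails_def by (auto simp: doubleton_eq_iff)

lemma edges_subset: "\<forall>e\<in>edges. e \<subseteq> {..<n}"
proof -
  have "Suc (col v) < n" for v
    using Suc_col_le[of v] L_less_n by (rule le_less_trans)
  then show ?thesis
    using L_less_n unfolding edges_def rails_def by auto
qed

lemma simple_graph_edges: "simple_graph {..<n} edges"
proof -
  have "card e = 2" if "e \<in> edges" for e
  proof -
    have "Suc (col v) \<noteq> v" if "L < v" for v
      using col_less[of v] that by linarith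
    then show ?thesis
      using that unfolding edges_def rails_def by (auto simp: card_insert_if)
  qed
  then show ?thesis
    using edges_subset by (auto simp: simple_graph_def)
qed

lemma finite_edges: "finite edges"
  using edges_subset by (intro finite_subset[of edges "Pow {..<n}"]) auto

lemma finite_site: "finite (site i j)"
  by (simp add: site_def)

lemma card_site:
  assumes "i < m" "j < L"
  shows "k \<le> card (site i j)"
proof -
  \<comment> \<open>Inverts the numbering of rows and columns; \<open>size\<close> keeps the first
    \<open>k\<close> vertices of each site below \<open>n\<close>.\<close>
  let ?f = "\<lambda>l. Suc L + ((l * m + i) * L + j)"
  have "?f l \<in> site i j" if "l < k" for l
  proof -
    have "l * m + i < Suc l * m"
      using assms by simp
    also have "\<dots> \<le> k * m"
      using that by (intro mult_le_mono1) simp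
    finally have "Suc (l * m + i) * L \<le> (k * m) * L"
      by (intro mult_le_mono1) simp
    then have "?f l < n"
      using assms size by (simp add: mult.commute)
    then show ?thesis
      using assms by (simp add: site_def row_def col_def)
  qed
  moreover have "inj_on ?f {..<k}"
    using m1 L5 by (auto simp: inj_on_def)
  ultimately have "card {..<k} \<le> card (site i j)"
    by (intro card_inj_on_le[of ?f]) (auto simp: finite_site)
  then show ?thesis
    by simp
qed

lemma ex_site: "i < m \<Longrightarrow> j < L \<Longrightarrow> \<exists>v. v \<in> site i j"
  using card_site[of i j] k1 by (metis card.empty ex_in_conv not_one_le_zero order_trans)

section \<open>Edge connectivity\<close>

text \<open>Two vertices of one site have at least \<open>k\<close> common neighbours in an adjacent
  site, and each deleted edge destroys at most one of them. A move to the next column takes an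
  intact rail and then corrects the position inside the site.\<close>

lemma row_connected:
  assumes D: "finite D" "card D < k" and uv: "u \<in> site i j" "v \<in> site i j'"
  shows "(u, v) \<in> (adj (rails - D))\<^sup>*"
proof -
  have im: "i < m" and jL: "j < L" "j' < L"
    using uv row_less col_less by (auto simp: site_def)
  have same: "(x, y) \<in> (adj (rails - D))\<^sup>*" if "x \<in> site i l" "y \<in> site i l" "l < L" for x y l
  proof -
    \<comment> \<open>Column 0 has no predecessor and uses column 1; every other column uses the
      previous one.\<close>
    define l' where "l' = (if l = 0 then 1 else l - 1)"
    have l': "l' < L" "l' = Suc l \<or> l = Suc l'"
      using \<open>l < L\<close> L5 by (auto simp: l'_def)
    have "\<exists>w\<in>site i l'. \<forall>e\<in>D. \<not> (e = {x, w} \<or> e = {y, w})"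
    proof (rule ex_avoiding[OF D(1)])
      show "card D < card (site i l')"
        using D(2) card_site[OF im l'(1)] by simp
    next
      fix w w' e
      assume "w \<in> site i l'" "w' \<in> site i l'" "e = {x, w} \<or> e = {y, w}" "e = {x, w'} \<or> e = {y, w'}"
      moreover have "x \<notin> site i l'" "y \<notin> site i l'"
        using that l' by (auto simp: site_def)
      ultimately show "w = w'"
        by (metis doubleton_eq_iff)
    qed
    then obtain w where w: "w \<in> site i l'" "{x, w} \<notin> D" "{y, w} \<notin> D"
      by blast
    have "{x, w} \<in> rails" "{y, w} \<in> rails"
      using that w l'(2) rail_edge by (metis insert_commute)+
    with w have "(x, w) \<in> adj (rails - D)" "(w, y) \<in> adj (rails - D)"
      by (simp_all add: insert_commute)
    then show ?thesis
      by (meson converse_rtrancl_into_rtrancl r_into_rtrancl)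
  qed
  have step: "(x, y) \<in> (adj (rails - D))\<^sup>*"
    if "x \<in> site i l" "y \<in> site i (Suc l)" "Suc l < L" for x y l
  proof -
    have "\<exists>w\<in>site i (Suc l). \<forall>e\<in>D. \<not> e = {x, w}"
    proof (rule ex_avoiding[OF D(1)])
      show "card D < card (site i (Suc l))"
        using D(2) card_site[OF im that(3)] by simp
    qed (metis doubleton_eq_iff)
    then obtain w where w: "w \<in> site i (Suc l)" "{x, w} \<notin> D"
      by blast
    then have "(x, w) \<in> adj (rails - D)"
      using rail_edge that by simp
    then show ?thesis
      using same[OF w(1) that(2,3)] by (rule converse_rtrancl_into_rtrancl)
  qed
  have up: "(x, y) \<in> (adj (rails - D))\<^sup>*" if "x \<in> site i l" "y \<in> site i (l + d)" "l + d < L" for x y l d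
    using that
  proof (induction d arbitrary: y)
    case 0
    then show ?case
      using same by simp
  next
    case (Suc d)
    obtain z where z: "z \<in> site i (l + d)"
      using ex_site[OF im, of "l + d"] Suc.prems by auto
    then have "(x, z) \<in> (adj (rails - D))\<^sup>*"
      using Suc by simp
    moreover have "(z, y) \<in> (adj (rails - D))\<^sup>*"
      using step[OF z] Suc.prems by simp
    ultimately show ?case
      by (rule rtrancl_trans)
  qed
  show ?thesis
  proof (cases "j \<le> j'")
    case True
    then show ?thesis
      using up[of u j v "j' - j"] uv jL by simp
  next
    case False
    then show ?thesis
      using up[of v j' u "j - j'"] uv jL by (intro reach_sym[of v u]) simp
  qed
qed

text \<open>Rows survive by \<open>row_connected\<close>, each hub keeps a spoke into every row, and
  the centre keeps a star edge. Hence every vertex reaches \<open>v0\<close> in row 0.\<close>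

lemma k_edge_connected_edges: "k_edge_connected k {..<n} edges"
proof -
  have "graph_connected {..<n} (edges - D)" if D: "finite D" "card D < k" for D
  proof -
    let ?R = "(adj (edges - D))\<^sup>*"
    have row: "(u, v) \<in> ?R" if "u \<in> site i j" "v \<in> site i j'" for u v i j j'
      using row_connected[OF D that] rails_subset by (elim reach_mono) blast
    have spoke: "\<exists>w\<in>site i j. (Suc j, w) \<in> ?R" if "i < m" "j < L" for i j
    proof -
      have "\<exists>w\<in>site i j. \<forall>e\<in>D. \<not> e = {Suc j, w}"
      proof (rule ex_avoiding[OF D(1)])
        show "card D < card (site i j)"
          using D(2) card_site[OF that] by simp
      qed (metis doubleton_eq_iff)
      then obtain w where w: "w \<in> site i j" "{Suc j, w} \<notin> D"
        by blast
      then have "(Suc j, w) \<in> adj (edges - D)"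
        using spoke_edge[of w] by (auto simp: site_def)
      with w(1) show ?thesis
        by blast
    qed
    obtain v0 where v0: "v0 \<in> site 0 0"
      using ex_site[of 0 0] m1 L5 by auto
    have hub: "(h, v0) \<in> ?R" if "1 \<le> h" "h \<le> L" for h
    proof -
      have "h - 1 < L" "Suc (h - 1) = h"
        using that by simp_all
      then obtain w where "w \<in> site 0 (h - 1)" "(h, w) \<in> ?R"
        using spoke[of 0 "h - 1"] m1 by auto
      then show ?thesis
        using row[OF _ v0] by (meson rtrancl_trans)
    qed
    have all: "(v, v0) \<in> ?R" if "v < n" for v
    proof -
      consider "v = 0" | "1 \<le> v" "v \<le> L" | "L < v"
        by linarith
      then show ?thesis
      proof cases
        case 1
        \<comment> \<open>Here \<open>k \<le> L\<close> enters: the centre has \<open>L\<close>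
          edges, more than \<open>card D\<close>.\<close>
        have "\<exists>h\<in>{1..L}. \<forall>e\<in>D. \<not> e = {0, h}"
          using D kL
          by (intro ex_avoiding[where r = "\<lambda>h e. e = {0, h}"]) (auto simp: doubleton_eq_iff)
        then obtain h where h: "1 \<le> h" "h \<le> L" "{0, h} \<notin> D"
          by (metis atLeastAtMost_iff)
        have "(v, h) \<in> adj (edges - D)"
          using star_edge[OF h(1,2)] h(3) 1 by simp
        then show ?thesis
          using hub[OF h(1,2)] by (rule converse_rtrancl_into_rtrancl)
      next
        case 2
        then show ?thesis
          by (rule hub)
      next
        case 3
        then have v: "v \<in> site (row v) (col v)"
          using that by (simp add: site_def)
        obtain w where w: "w \<in> site (row v) (col v)" "(Suc (col v), w) \<in> ?R"
          using spoke[of "row v" "col v"] by auto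
        have "(Suc (col v), v0) \<in> ?R"
          using hub[of "Suc (col v)"] by (simp add: Suc_leI)
        then show ?thesis
          using row[OF v w(1)] reach_sym[OF w(2)] by (meson rtrancl_trans)
      qed
    qed
    have "(u, v) \<in> ?R" if "u < n" "v < n" for u v
      using all[OF that(1)] reach_sym[OF all[OF that(2)]] by (rule rtrancl_trans)
    moreover have "\<forall>e\<in>edges - D. e \<subseteq> {..<n}"
      using edges_subset by blast
    moreover have "{..<n} \<noteq> {}"
      using L_less_n by auto
    ultimately show ?thesis
      by (simp add: graph_connected_iff)
  qed
  then show ?thesis
    using L_less_n L5 by (auto simp: k_edge_connected_def)
qed

section \<open>Diameter\<close>

lemma hop_diameter_edges: "hop_diameter {..<n} edges = 4"
proof -
  \<comment> \<open>Potential for the lower bound: column numbers capped at 4, and hub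
    \<open>h\<close> one above its column \<open>h - 1\<close>. Hubs are capped at 3 because all of
    them are adjacent to the centre, which has value 2.\<close>
  define f where "f v = (if v = 0 then 2 else if v \<le> L then min 3 v else min 4 (col v))" for v
  obtain u v where uv: "u \<in> site 0 0" "v \<in> site 0 4"
    using ex_site[of 0 0] ex_site[of 0 4] m1 L5 by auto
  have centre: "\<exists>l\<le>2. (x, 0) \<in> adj edges ^^ l \<and> (0, x) \<in> adj edges ^^ l" if "x < n" for x
  proof -
    consider "x = 0" | "1 \<le> x" "x \<le> L" | "L < x"
      by linarith
    then show ?thesis
    proof cases
      case 1
      then show ?thesis
        by (intro exI[of _ 0]) auto
    next
      case 2
      then show ?thesis
        using star_edge[of x] by (intro exI[of _ 1]) (auto simp: insert_commute)
    next
      case 3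
      have "{0, Suc (col x)} \<in> edges" "{Suc (col x), x} \<in> edges"
        using star_edge[of "Suc (col x)"] spoke_edge[of x] 3 that by (auto simp: Suc_leI)
      then have "(x, 0) \<in> adj edges ^^ 2" "(0, x) \<in> adj edges ^^ 2"
        by (auto simp: numeral_2_eq_2 insert_commute)
      then show ?thesis
        by blast
    qed
  qed
  show ?thesis
  proof (rule hop_diameter_eqI[OF edges_subset, of 4 f u v])
    fix x y assume "x \<in> {..<n}" "y \<in> {..<n}"
    then obtain l l' where l: "l \<le> 2" "l' \<le> 2"
      "(x, 0) \<in> adj edges ^^ l" "(0, y) \<in> adj edges ^^ l'"
      using centre[of x] centre[of y] by auto
    then have "(x, y) \<in> adj edges ^^ (l + l')"
      by (auto simp: relpow_add)
    with l show "\<exists>l\<le>4. (x, y) \<in> adj edges ^^ l"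
      by (intro exI[of _ "l + l'"]) auto
  next
    fix x y assume "{x, y} \<in> edges"
    then show "f y \<le> Suc (f x)"
    proof (cases rule: edge_cases)
      case spoke
      then show ?thesis
        using col_less[of y] by (auto simp: f_def)
    next
      case spoke'
      then show ?thesis
        using col_less[of x] by (auto simp: f_def)
    qed (auto simp: f_def)
  qed (use uv in \<open>auto simp: site_def f_def\<close>)
qed

section \<open>Encoding a set in the weights and decoding it from the tree\<close>

text \<open>The set \<open>x\<close> of rows is encoded in the weights at hub 1 and has to be decoded at hub \<open>L\<close>.\<close>

definition weight :: "nat set \<Rightarrow> nat set \<Rightarrow> nat" where
  "weight x e = (let u = Min e; v = Max e in
     if 1 \<le> u \<and> u \<le> L \<and> L < v
     then if u = L then 2 else if u = 1 \<and> row v \<in> x then 1 else 3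
     else 1)"

lemma weight_range: "1 \<le> weight x e" "weight x e \<le> 3"
  by (auto simp: weight_def Let_def)

lemma weight_star: "weight x {0, h} = 1"
  by (simp add: weight_def)

text \<open>Hubs have smaller numbers than row vertices, so \<open>Min\<close> picks the hub of the
  unordered edge and \<open>Max\<close> its row vertex.\<close>

lemma weight_spoke:
  assumes "L < v"
  shows "weight x {Suc (col v), v} =
     (if Suc (col v) = L then 2 else if col v = 0 \<and> row v \<in> x then 1 else 3)"
proof -
  have "Suc (col v) < v"
    using Suc_col_le[of v] assms by linarith
  then show ?thesis
    using assms L5 by (auto simp: weight_def Let_def min_def max_def)
qed

lemma weight_rail:
  assumes "e \<in> rails"
  shows "weight x e = 1"
proof -
  have "\<not> Min e \<le> L"
    using assms by (auto simp: rails_def min_def split: if_splits)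
  then show ?thesis
    by (simp add: weight_def Let_def)
qed

lemma light_row:
  assumes "u \<in> site i j" "v \<in> site i j'" "1 < c"
  shows "(u, v) \<in> (adj {e \<in> edges. weight x e < c})\<^sup>*"
proof -
  have "(u, v) \<in> (adj (rails - {}))\<^sup>*"
    using k1 by (intro row_connected[OF _ _ assms(1,2)]) auto
  then show ?thesis
    using assms(3) rails_subset by (elim reach_mono) (auto simp: weight_rail)
qed

text \<open>The walk is hub \<open>h\<close>, centre, hub \<open>j + 1\<close>, \<open>w\<close>,
  then along the row to \<open>v\<close>. Star edges and rails weigh 1, so only the spoke at
  \<open>w\<close> matters.\<close>

lemma light_detour:
  assumes h: "1 \<le> h" "h \<le> L" and j: "j < L" and w: "w \<in> site i j" and v: "v \<in> site i j'"
    and c: "weight x {Suc j, w} < c" "1 < c"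
  shows "(h, v) \<in> (adj {e \<in> edges. weight x e < c})\<^sup>*"
proof -
  let ?A = "adj {e \<in> edges. weight x e < c}"
  have "{h, 0} \<in> edges"
    using star_edge[OF h] by (simp only: insert_commute[of h 0])
  moreover have "{0, Suc j} \<in> edges"
    using j by (intro star_edge) simp_all
  moreover have "weight x {h, 0} = 1"
    using weight_star[of x h] by (simp only: insert_commute[of h 0])
  ultimately have 1: "(h, 0) \<in> ?A" "(0, Suc j) \<in> ?A"
    using c(2) weight_star[of x "Suc j"] by simp_all
  have 2: "(Suc j, w) \<in> ?A"
    using c(1) w spoke_edge[of w] by (simp add: site_def)
  have "(w, v) \<in> ?A\<^sup>*"
    using light_row[OF w v c(2)] .
  then show ?thesis
    by (rule converse_rtrancl_into_rtrancl[OF 1(1) converse_rtrancl_into_rtrancl[OF 1(2)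
      converse_rtrancl_into_rtrancl[OF 2]]])
qed

text \<open>Spokes of hub \<open>L\<close> weigh 2. If \<open>i \<in> x\<close>, they lose to the
  route through hub 1, whose spokes into row \<open>i\<close> weigh 1. Otherwise all other spokes of
  the row weigh 3 and lose to those of hub \<open>L\<close>.\<close>

lemma mst_decodes:
  assumes mst: "is_mst {..<n} edges (weight x) F" and i: "i < m"
  shows "i \<in> x \<longleftrightarrow> \<not> (\<exists>v\<in>site i (L - 1). {L, v} \<in> F)"
proof
  note no_path = is_mst_no_lighter_path[OF edges_subset finite_edges mst]
  have SL: "Suc (L - 1) = L"
    using L5 by simp
  have pos: "weight x e > 0" for e
    using weight_range(1)[of x e] by simp
  show "\<not> (\<exists>v\<in>site i (L - 1). {L, v} \<in> F)" if "i \<in> x"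
  proof
    assume "\<exists>v\<in>site i (L - 1). {L, v} \<in> F"
    then obtain v where v: "v \<in> site i (L - 1)" "{L, v} \<in> F"
      by blast
    obtain w where w: "w \<in> site i 0"
      using ex_site[OF i, of 0] L5 by auto
    have "weight x {L, v} = 2"
      using v(1) weight_spoke[of v x] SL by (simp add: site_def)
    moreover have "weight x {Suc 0, w} = 1"
      using w weight_spoke[of w x] \<open>i \<in> x\<close> L5 by (auto simp: site_def)
    ultimately have "(L, v) \<in> (adj {e \<in> edges. weight x e < weight x {L, v}})\<^sup>*"
      using L5 by (intro light_detour[OF _ _ _ w v(1)]) auto
    with no_path[OF v(2) pos] show False .
  qed
  show "i \<in> x" if no: "\<not> (\<exists>v\<in>site i (L - 1). {L, v} \<in> F)"
  proof (rule ccontr)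
    assume "i \<notin> x"
    have F: "F \<subseteq> edges" "graph_connected {..<n} F"
      using mst by (auto simp: is_mst_def spanning_tree_def)
    obtain v where v: "v \<in> site i 0"
      using ex_site[OF i, of 0] L5 by auto
    have "\<forall>e\<in>F. e \<subseteq> {..<n}"
      using F(1) edges_subset by blast
    then have "(v, 0) \<in> (adj F)\<^sup>*"
      using F(2) v by (auto simp: graph_connected_iff site_def)
    \<comment> \<open>The tree must leave row \<open>i\<close> to reach the centre, and only spokes
      leave a row.\<close>
    then obtain a b where ab: "{a, b} \<in> F" "a \<in> {v. L < v \<and> v < n \<and> row v = i}"
      "b \<notin> {v. L < v \<and> v < n \<and> row v = i}"
      using rtrancl_crossing[of v 0 "adj F" "{v. L < v \<and> v < n \<and> row v = i}"] v
      by (auto simp: site_def adj_def)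
    then have "{a, b} \<in> edges"
      using F(1) by blast
    then have b: "b = Suc (col a)"
      using ab(2,3) Suc_col_le[of b] by (cases rule: edge_cases) auto
    have a: "a \<in> site i (col a)"
      using ab by (simp add: site_def)
    have "Suc (col a) \<noteq> L"
    proof
      assume "Suc (col a) = L"
      then have "col a = L - 1"
        by simp
      then have "a \<in> site i (L - 1)" "{L, a} \<in> F"
        using a ab(1) b \<open>Suc (col a) = L\<close> by (simp_all add: insert_commute)
      with no show False
        by blast
    qed
    then have wa: "weight x {b, a} = 3"
      using weight_spoke[of a x] ab(2) b \<open>i \<notin> x\<close> by simp
    \<comment> \<open>The detour from hub \<open>b\<close> runs through hub \<open>L\<close>, whose
      spoke of weight 2 undercuts the 3 of \<open>{b, a}\<close>.\<close>
    obtain w where w: "w \<in> site i (L - 1)"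
      using ex_site[OF i, of "L - 1"] L5 by auto
    have "weight x {Suc (L - 1), w} = 2"
      using w weight_spoke[of w x] SL by (simp add: site_def)
    then have "(b, a) \<in> (adj {e \<in> edges. weight x e < weight x {b, a}})\<^sup>*"
      using L5 wa b by (intro light_detour[OF _ _ _ w a]) (auto simp: Suc_leI)
    with no_path[of b a] pos ab(1) show False
      by (simp add: insert_commute)
  qed
qed

section \<open>Spread of information away from hub 1\<close>

text \<open>Position along the rows, with hub \<open>h\<close> placed at its column
  \<open>h - 1\<close>. Truncated subtraction gives the centre 0 as well, hence its separate
  treatment below.\<close>

definition depth :: "nat \<Rightarrow> nat" where
  "depth v = (if v \<le> L then v - 1 else col v)"

lemma depth_edge: "{u, v} \<in> edges \<Longrightarrow> u \<noteq> 0 \<Longrightarrow> v \<noteq> 0 \<Longrightarrow> depth v \<le> Suc (depth u)"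
  by (erule edge_cases) (auto simp: depth_def Suc_leI)

text \<open>Only spokes of column 0 depend on \<open>x\<close>, and both ends of such a spoke have
  depth 0.\<close>

lemma weight_indep:
  assumes "{u, v} \<in> edges" "v = 0 \<or> 0 < depth v"
  shows "weight x {u, v} = weight y {u, v}"
  using assms(1)
proof (cases rule: edge_cases)
  case spoke
  then show ?thesis
    using assms(2) by (simp add: weight_spoke depth_def)
next
  case spoke'
  then show ?thesis
    using assms(2) col_less[of u] by (simp add: weight_spoke insert_commute[of u] depth_def Suc_leI)
next
  case star'
  then show ?thesis
    by (simp add: insert_commute[of u] weight_star)
next
  case rail
  then have "{u, v} \<in> rails"
    unfolding rails_def by blast
  then show ?thesis
    by (simp add: weight_rail)
next
  case rail'
  then have "{v, u} \<in> rails"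
    unfolding rails_def by (intro CollectI exI[of _ v] exI[of _ u]) auto
  then show ?thesis
    by (simp add: weight_rail insert_commute[of u])
qed (simp add: weight_star)

lemma local_input_indep:
  "v = 0 \<or> 0 < depth v \<Longrightarrow> local_input edges (weight x) v = local_input edges (weight y) v"
  using weight_indep by (auto simp: local_input_def)

text \<open>Information about \<open>x\<close> moves by one column per round, unless it passes through the centre.\<close>

lemma run_indep:
  assumes centre: "run edges A (weight x) \<omega> T 0 = run edges A (weight y) \<omega> T 0"
  shows "t \<le> T \<Longrightarrow> v \<noteq> 0 \<Longrightarrow> t < depth v \<Longrightarrow>
    run edges A (weight x) \<omega> t v = run edges A (weight y) \<omega> t v"
proof (induction t arbitrary: v)
  case (Suc t)
  have "send A u (local_input edges (weight x) u) (\<lambda>i. \<omega> (u, i)) (run edges A (weight x) \<omega> t u) v =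
      send A u (local_input edges (weight y) u) (\<lambda>i. \<omega> (u, i)) (run edges A (weight y) \<omega> t u) v"
    if "{u, v} \<in> edges" for u
  proof (cases "u = 0")
    case True
    \<comment> \<open>The earlier histories of the centre are prefixes of the common one at time
      \<open>T\<close>.\<close>
    have "run edges A (weight x) \<omega> t 0 = run edges A (weight y) \<omega> t 0"
      using centre Suc.prems(1) by (metis Suc_leD take_run)
    then show ?thesis
      using True local_input_indep[of 0 x y] by simp
  next
    case False
    then have "t < depth u"
      using depth_edge[OF that] Suc.prems by simp
    then show ?thesis
      using Suc.IH[of u] local_input_indep[of u x y] Suc.prems False by simp
  qed
  then show ?case
    using Suc by (auto simp: fun_eq_iff)
qed simp

section \<open>Round lower bound by counting histories of the centre\<close>

text \<open>If both alternatives fail, hub \<open>L\<close> learns about \<open>x\<close> only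
  through the centre, whose histories are too few. The inner \<open>Suc\<close> accounts for all
  strings up to the length bound; the outer one is a spare bit that pays for the success
  probability.\<close>

theorem rounds_lower_bound:
  assumes B: "bandwidth A B" and mst: "computes_mst {..<n} edges A t"
  shows "L - 1 \<le> t \<or> m \<le> Suc (Suc (nat \<lfloor>B\<rfloor>) * L * t)"
proof (rule disjCI)
  define b where "b = nat \<lfloor>B\<rfloor>"
  assume "\<not> m \<le> Suc (Suc (nat \<lfloor>B\<rfloor>) * L * t)"
  then have m_large: "Suc (Suc b * L * t) < m"
    by (simp add: b_def)
  show "L - 1 \<le> t"
  proof (rule ccontr)
    assume "\<not> L - 1 \<le> t"
    interpret prob_space coin_space
      by (rule prob_space_coin_space)
    define S where "S x = {\<omega> \<in> space coin_space. outputs_mst {..<n} edges A (weight x) \<omega> t}" for x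
    have "weight x e \<le> card {..<n} ^ 2" for x e
    proof -
      have "weight x e \<le> 2 ^ 2"
        using weight_range(2)[of x e] by simp
      also have "\<dots> \<le> card {..<n} ^ 2"
        using L_less_n L5 by (intro power_mono) auto
      finally show ?thesis .
    qed
    then have "S x \<in> events" "2 / 3 \<le> prob (S x)" for x
      using mst weight_range(1) unfolding computes_mst_def S_def by blast+
    \<comment> \<open>One choice of coins is correct for at least two thirds of all
      \<open>2 ^ m\<close> sets; from here on the run is deterministic.\<close>
    then obtain \<omega> where \<omega>: "2 / 3 * card (Pow {..<m}) \<le> card {x \<in> Pow {..<m}. \<omega> \<in> S x}"
      using ex_outcome_average[of "Pow {..<m}" S "2 / 3"] by auto
    define G where "G = {x \<in> Pow {..<m}. \<omega> \<in> S x}"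
    let ?h = "\<lambda>x. run edges A (weight x) \<omega> t 0"
    \<comment> \<open>The history of the centre fixes the answer of hub \<open>L\<close>, whose
      depth \<open>L - 1\<close> exceeds \<open>t\<close>, and this answer determines
      \<open>x\<close>.\<close>
    have "inj_on ?h G"
    proof (rule inj_onI)
      fix x y assume xy: "x \<in> G" "y \<in> G" "?h x = ?h y"
      obtain F F' where F: "is_mst {..<n} edges (weight x) F" "is_mst {..<n} edges (weight y) F'"
        and res: "result edges A (weight x) \<omega> t L = {e \<in> F. L \<in> e}"
          "result edges A (weight y) \<omega> t L = {e \<in> F'. L \<in> e}"
        using xy(1,2) L_less_n by (auto simp: G_def S_def outputs_mst_def)
      have dL: "t < depth L" "L \<noteq> 0"
        using \<open>\<not> L - 1 \<le> t\<close> L5 by (auto simp: depth_def)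
      then have "result edges A (weight x) \<omega> t L = result edges A (weight y) \<omega> t L"
        using run_indep[OF xy(3) le_refl, of L] local_input_indep[of L x y]
        by (simp add: result_def)
      then have "{e \<in> F. L \<in> e} = {e \<in> F'. L \<in> e}"
        using res by simp
      then have "{L, v} \<in> F \<longleftrightarrow> {L, v} \<in> F'" for v
        by blast
      then have "i \<in> x \<longleftrightarrow> i \<in> y" if "i < m" for i
        using mst_decodes[OF F(1) that] mst_decodes[OF F(2) that] by simp
      moreover have "x \<subseteq> {..<m}" "y \<subseteq> {..<m}"
        using xy(1,2) by (auto simp: G_def)
      ultimately show "x = y"
        by blast
    qed
    have msg: "length (send A u z r h v) \<le> b" for u z r h v
      using B unfolding bandwidth_def b_def by (meson le_floor_iff le_nat_floor)
    have centre: "u \<in> {1..L}" if "{u, 0} \<in> edges" for u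
      using that by (cases rule: edge_cases) auto
    have "length (f u) \<le> b \<and> (u \<notin> {1..L} \<longrightarrow> f u = [])" if "f \<in> set (?h x)" for f u x
      using run_message[OF that, of u] msg centre by auto
    then have "?h ` G \<subseteq> {h. length h = t \<and> (\<forall>f\<in>set h. (\<forall>u\<in>{1..L}. length (f u) \<le> b) \<and>
        (\<forall>u. u \<notin> {1..L} \<longrightarrow> f u = []))}"
      by auto
    then have "card (?h ` G) \<le> 2 ^ (Suc b * card {1..L} * t)"
      using card_histories_le[of "{1..L}" t b] by (meson card_mono finite_atLeastAtMost le_trans)
    then have "card G \<le> 2 ^ (Suc b * L * t)"
      using \<open>inj_on ?h G\<close> by (simp add: card_image)
    then have "real (card G) \<le> real (2 ^ (Suc b * L * t))"
      by (simp only: of_nat_le_iff)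
    then have "real (card G) \<le> 2 ^ (Suc b * L * t)"
      by (simp only: of_nat_power of_nat_numeral)
    moreover have "2 / 3 * 2 ^ m \<le> real (card G)"
      using \<omega> by (simp add: G_def card_Pow)
    moreover have "(2::real) ^ (Suc (Suc b * L * t)) \<le> 2 ^ m"
      using m_large by (intro power_increasing) auto
    \<comment> \<open>Two thirds of twice the bound on the histories exceeds that bound.\<close>
    ultimately have "2 / 3 * (2 * (2::real) ^ (Suc b * L * t)) \<le> 2 ^ (Suc b * L * t)"
      unfolding power_Suc by linarith
    moreover have "(2::real) ^ (Suc b * L * t) > 0"
      by simp
    ultimately show False
      by linarith
  qed
qed

end

section \<open>Choice of the parameters\<close>

text \<open>\<open>L\<close> is of order \<open>y\<close>, and \<open>m\<close> of order
  \<open>n / (k * L)\<close>, that is \<open>y\<^sup>2\<close>. The assumption \<open>n1\<close>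
  makes \<open>y\<close> large compared with \<open>M\<close>.\<close>

lemma grid_parameters:
  fixes n k :: nat and K :: real
  defines "M \<equiv> K powr (4/3) + 7" and "y \<equiv> (real n / real k) powr (1/3)"
  assumes K: "K > 0" and k: "1 \<le> k" "real k \<le> K * real n powr (1/4)"
    and n1: "K * (8 * M) ^ 3 \<le> real n powr (3/4)" and n2: "4 * M \<le> real n powr (2/3)"
  shows "\<exists>L m. blown_up_grid n L m k \<and> y \<le> real (L - 1) \<and> real L \<le> M * y \<and>
    y\<^sup>2 / (4 * M) \<le> real m - 1"
proof -
  have M: "M > 7"
    using K by (simp add: M_def)
  have n: "real n > 0"
    using n2 M by (cases "n = 0") auto
  have kpos: "real k > 0"
    using k by simp
  have y3: "y ^ 3 = real n / real k"
    using n kpos by (simp add: y_def powr_power)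
  have y: "8 * M \<le> y"
  proof -
    have "K * (8 * M) ^ 3 * real n powr (1/4) \<le> real n powr (3/4) * real n powr (1/4)"
      using n1 by (intro mult_right_mono) auto
    also have "\<dots> = real n"
      using n by (simp flip: powr_add)
    finally have "(8 * M) ^ 3 * (K * real n powr (1/4)) \<le> real n"
      by (simp add: mult_ac)
    moreover have "(8 * M) ^ 3 * real k \<le> (8 * M) ^ 3 * (K * real n powr (1/4))"
      using k M by (intro mult_left_mono) auto
    ultimately have "(8 * M) ^ 3 \<le> y ^ 3"
      using kpos by (simp add: y3 le_divide_eq)
    then show ?thesis
      by (subst (asm) power_mono_iff) (use M in \<open>auto simp: y_def\<close>)
  qed
  \<comment> \<open>Here the bound on \<open>k\<close> enters: \<open>k ^ 4 \<le> K ^ 4 * n\<close>,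
    divided by \<open>k\<close>, compares the cubes of both sides.\<close>
  have k_le: "real k \<le> K powr (4/3) * y"
  proof -
    have "real k ^ 4 \<le> (K * real n powr (1/4)) ^ 4"
      using k by (intro power_mono) auto
    also have "\<dots> = K ^ 4 * real n"
      using n by (simp add: power_mult_distrib powr_power)
    finally have "real k ^ 3 \<le> K ^ 4 * (real n / real k)"
      using kpos by (simp add: field_simps eval_nat_numeral)
    also have "\<dots> = (K powr (4/3) * y) ^ 3"
    proof -
      have "(K powr (4/3)) ^ 3 = K ^ 4"
        using K by (simp add: powr_power)
      then show ?thesis
        by (simp only: power_mult_distrib y3)
    qed
    finally show ?thesis
      by (subst (asm) power_mono_iff) (use K in \<open>auto simp: y_def\<close>)
  qed
  \<comment> \<open>\<open>M - 6\<close> is \<open>K powr (4/3) + 1\<close>, enough for both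
    \<open>k \<le> L\<close> and \<open>y \<le> L - 1\<close>. The summand 5 ensures
    \<open>5 \<le> L\<close>; together with rounding it is covered by \<open>6 * y\<close>.\<close>
  define L where "L = nat \<lceil>(M - 6) * y\<rceil> + 5"
  have ypos: "y > 1"
    using y M by simp
  have "0 \<le> (M - 6) * y"
    using M ypos by simp
  then have L: "(M - 6) * y + 5 \<le> real L" "real L \<le> (M - 6) * y + 6"
    unfolding L_def by linarith+
  have LM: "real L \<le> M * y"
    using L(2) ypos by (simp add: algebra_simps)
  have yL: "y \<le> real (L - 1)"
  proof -
    have "1 * y \<le> (M - 6) * y"
      using M ypos by (intro mult_right_mono) auto
    then show ?thesis
      using L(1) by linarith
  qed
  have kL: "k \<le> L"
  proof -
    have "K powr (4/3) * y \<le> (M - 6) * y"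
      using ypos by (intro mult_right_mono) (auto simp: M_def)
    then have "real k \<le> real L"
      using k_le L(1) by linarith
    then show ?thesis
      by simp
  qed
  \<comment> \<open>By \<open>n2\<close>, centre and hubs take at most half of the vertices.\<close>
  have half: "real L + 1 \<le> real n / 2"
  proof -
    have "y \<le> real n powr (1/3)"
      unfolding y_def using n k by (intro powr_mono2) (auto simp: divide_le_eq)
    then have "4 * M * y \<le> real n powr (2/3) * real n powr (1/3)"
      using n2 M ypos by (intro mult_mono) auto
    also have "\<dots> = real n"
      using n by (simp flip: powr_add)
    finally have "4 * (M * y) \<le> real n"
      by simp
    moreover have "1 \<le> M * y"
      using mult_mono[of 1 M 1 y] M ypos by simp
    ultimately show ?thesis
      using LM by linarith
  qed
  define m where "m = (n - Suc L) div (k * L)"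
  have Lpos: "real L > 0"
    using yL ypos by linarith
  have kLpos: "real (k * L) > 0"
    using kpos Lpos by simp
  have "y\<^sup>2 / (2 * M) = (real n / real k) / (2 * (M * y))"
    using ypos M by (simp add: y3[symmetric] field_simps eval_nat_numeral)
  also have "\<dots> \<le> (real n / real k) / (2 * real L)"
    using LM Lpos kpos n M ypos by (intro divide_left_mono mult_pos_pos) auto
  also have "\<dots> = (real n / 2) / real (k * L)"
    by simp
  also have "\<dots> \<le> (real n - real (Suc L)) / real (k * L)"
    using half kLpos by (intro divide_right_mono) auto
  also have "\<dots> = real (n - Suc L) / real (k * L)"
    using half by (subst of_nat_diff) auto
  also have "\<dots> \<le> real m + 1"
  proof -
    have "n - Suc L \<le> (m + 1) * (k * L)"
      using dividend_less_div_times[of "k * L" "n - Suc L"] kpos Lpos by (simp add: m_def)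
    then have "real (n - Suc L) \<le> real ((m + 1) * (k * L))"
      by (simp only: of_nat_le_iff)
    also have "\<dots> = (real m + 1) * real (k * L)"
      by (simp add: algebra_simps)
    finally show ?thesis
      using kLpos by (simp only: pos_divide_le_eq)
  qed
  finally have m: "y\<^sup>2 / (2 * M) \<le> real m + 1" .
  \<comment> \<open>Half of \<open>y\<^sup>2 / (2 * M)\<close> is at least 2, which absorbs the
    rounding of \<open>m\<close> and the 1 subtracted in the conclusion.\<close>
  have "2 \<le> y\<^sup>2 / (4 * M)"
  proof -
    have "8 * M * 1 \<le> y * y"
      using y ypos M by (intro mult_mono) auto
    then show ?thesis
      using M by (simp add: le_divide_eq power2_eq_square)
  qed
  moreover have "y\<^sup>2 / (2 * M) = y\<^sup>2 / (4 * M) + y\<^sup>2 / (4 * M)"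
    by simp
  ultimately have m': "y\<^sup>2 / (4 * M) \<le> real m - 1" and m1: "1 \<le> real m"
    using m by linarith+
  have "m * (k * L) \<le> n - Suc L"
    unfolding m_def by simp
  moreover have "Suc L \<le> n"
    using half by linarith
  ultimately have "Suc L + m * k * L \<le> n"
    by (simp add: mult.assoc)
  then have "blown_up_grid n L m k"
    using k(1) kL m1 by unfold_locales (auto simp: L_def)
  with yL LM m' show ?thesis
    by blast
qed

text \<open>\<open>K\<close> and \<open>\<beta>\<close> are the constants hidden in the bounds on
  \<open>k\<close> and on the message length. The polylogarithmic loss is a single
  logarithm.\<close>

theorem theorem7p5:
  fixes K \<beta> :: real
  assumes "K > 0" and "\<beta> > 0"
  shows "\<exists>c>0. \<exists>a n0 :: nat. \<forall>n\<ge>n0. \<forall>k::nat.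
    1 \<le> k \<and> real k \<le> K * real n powr (1/4) \<longrightarrow>
    (\<exists>E. simple_graph {..<n} E \<and> k_edge_connected k {..<n} E \<and> hop_diameter {..<n} E = 4 \<and>
       (\<forall>A t. bandwidth A (\<beta> * log 2 (real n)) \<and> computes_mst {..<n} E A t \<longrightarrow>
          real t \<ge> c * (real n / real k) powr (1/3) / log 2 (real n) ^ a))"
proof -
  define M where "M = K powr (4/3) + 7"
  \<comment> \<open>Comes from solving
    \<open>y\<^sup>2 / (4 * M) \<le> (\<beta> + 1) * l * (M * y) * t\<close> for \<open>t\<close>;
    the case \<open>L - 1 \<le> t\<close> only asks for \<open>c \<le> 1\<close>.\<close>
  define c where "c = 1 / (4 * M\<^sup>2 * (\<beta> + 1))"
  have M: "M > 7"
    using assms(1) by (simp add: M_def)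
  have c: "c > 0"
    using M assms(2) by (simp add: c_def)
  have c1: "c \<le> 1"
  proof -
    have "1 \<le> M\<^sup>2"
      using M by (intro one_le_power) simp
    then have "1 * 1 \<le> (4 * M\<^sup>2) * (\<beta> + 1)"
      using assms(2) by (intro mult_mono) auto
    then have "1 / (4 * M\<^sup>2 * (\<beta> + 1)) \<le> 1 / 1"
      by (intro frac_le) auto
    then show ?thesis
      by (simp add: c_def)
  qed
  have "filterlim (\<lambda>n. real n powr (3/4)) at_top sequentially"
    "filterlim (\<lambda>n. real n powr (2/3)) at_top sequentially"
    by real_asymp+
  then have "\<forall>\<^sub>F n in sequentially. K * (8 * M) ^ 3 \<le> real n powr (3/4) \<and>
      4 * M \<le> real n powr (2/3) \<and> 2 \<le> n"
    by (intro eventually_conj eventually_ge_at_top) (auto simp: filterlim_at_top)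
  then obtain n0 where n0: "\<And>n. n \<ge> n0 \<Longrightarrow> K * (8 * M) ^ 3 \<le> real n powr (3/4) \<and>
      4 * M \<le> real n powr (2/3) \<and> 2 \<le> n"
    by (auto simp: eventually_sequentially)
  have "\<exists>E. simple_graph {..<n} E \<and> k_edge_connected k {..<n} E \<and> hop_diameter {..<n} E = 4 \<and>
       (\<forall>A t. bandwidth A (\<beta> * log 2 (real n)) \<and> computes_mst {..<n} E A t \<longrightarrow>
          real t \<ge> c * (real n / real k) powr (1/3) / log 2 (real n) ^ 1)"
    if n: "n \<ge> n0" and k: "1 \<le> k" "real k \<le> K * real n powr (1/4)" for n k
  proof -
    define y where "y = (real n / real k) powr (1/3)"
    define l where "l = log 2 (real n)"
    have l: "l \<ge> 1"
      using n0[OF n] by (simp add: l_def le_log_iff)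
    obtain L m where grid: "blown_up_grid n L m k" and yL: "y \<le> real (L - 1)"
      and LM: "real L \<le> M * y" and m: "y\<^sup>2 / (4 * M) \<le> real m - 1"
      using grid_parameters[OF assms(1) k] n0[OF n] unfolding M_def y_def by blast
    interpret blown_up_grid n L m k
      by (rule grid)
    have y: "y > 0"
      using L_less_n k by (simp add: y_def)
    have "c * y / l \<le> real t"
      if A: "bandwidth A (\<beta> * l)" "computes_mst {..<n} edges A t" for A t
      using rounds_lower_bound[OF A]
    proof
      assume "L - 1 \<le> t"
      have "c * y / l \<le> y / 1"
        using c c1 y l by (intro frac_le mult_left_le_one_le) auto
      also have "\<dots> \<le> real t"
        using yL \<open>L - 1 \<le> t\<close> by simp
      finally show ?thesis .
    next
      let ?b = "nat \<lfloor>\<beta> * l\<rfloor>"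
      assume "m \<le> Suc (Suc ?b * L * t)"
      then have "real m \<le> real (Suc (Suc ?b * L * t))"
        by (simp only: of_nat_le_iff)
      then have "real m - 1 \<le> real (Suc ?b) * real L * real t"
        by (simp only: of_nat_Suc of_nat_mult)
      also have "\<dots> \<le> ((\<beta> + 1) * l) * (M * y) * real t"
      proof (intro mult_mono)
        \<comment> \<open>As \<open>l \<ge> 1\<close>, the extra 1 in \<open>Suc ?b\<close> fits
          into the factor \<open>\<beta> + 1\<close>.\<close>
        have "0 \<le> \<beta> * l"
          using assms(2) l by simp
        then have "real (Suc ?b) \<le> \<beta> * l + 1"
          by linarith
        also have "\<dots> \<le> (\<beta> + 1) * l"
          using l by (simp add: algebra_simps)
        finally show "real (Suc ?b) \<le> (\<beta> + 1) * l" .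
      qed (use LM l M y assms(2) in auto)
      finally have "y\<^sup>2 / (4 * M) \<le> ((\<beta> + 1) * l) * (M * y) * real t"
        using m by linarith
      then have "y * y \<le> y * (4 * M\<^sup>2 * (\<beta> + 1) * (real t * l))"
        using M by (simp add: power2_eq_square divide_le_eq mult_ac)
      then have "y \<le> 4 * M\<^sup>2 * (\<beta> + 1) * (real t * l)"
        using y by (simp only: mult_le_cancel_left_pos)
      moreover have "4 * M\<^sup>2 * (\<beta> + 1) > 0"
        using M assms(2) by simp
      ultimately have "c * y \<le> real t * l"
        by (simp add: c_def divide_le_eq mult_ac)
      then show ?thesis
        using l by (simp add: divide_le_eq)
    qed
    then show ?thesis
      using simple_graph_edges k_edge_connected_edges hop_diameter_edges
      unfolding y_def l_def by (intro exI[of _ edges]) auto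
  qed
  with c show ?thesis
    by (intro exI[of _ c] conjI exI[of _ "1::nat"] exI[of _ n0]) blast+
qed

end
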